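(* Let $E(0)\subset\mathbb{R}^3$ be an ellipsoid (centered at the origin) with its axes on the coordinate axes. Let $E(t)$ be the family of convex bodies generated by the evolution starting at $E(0)$ under the radial distance-driven flow $r_t=f(r)$, where $f$ is a $C^1$ function with $f(0)=0$ that is strictly decreasing for $r>0$ and is either strictly convex for $r>0$ or strictly concave for $r>0$. (i) If $f$ is strictly convex for $r>0$, then both axis ratios of $E(t)$ are monotonically decreasing functions of the time $t$. (ii) If $f$ is strictly concave for $r>0$, then both axis ratios of $E(t)$ are monotonically increasing functions of the time $t$.
   Context: Radial distance-driven flow: the boundary of $E(t)$ is $\{r(u,t)u:u\in\mathbb{S}^2\}$, where $r$ is the radial distance measured from the origin; for each $u\in\mathbb{S}^2$ the function $t\mapsto r(u,t)$ solves $r_t(u,t)=f(r(u,t))$ (subscript $t$ denotes the time derivative), and $r(u,0)$ is the distance from the origin to the boundary of $E(0)$ in direction $u$. Each $E(t)$ is symmetric with respect to the three coordinate planes. For a convex body $K\subset\mathbb{R}^3$ symmetric with respect to the three coordinate planes, the approximating ellipsoid of $K$ is the ellipsoid whose axes lie on the coordinate axes and whose boundary contains the boundary points of $K$ on the coordinate axes; the axis ratios of $K$ are those of its approximating ellipsoid. Thus, if $c(t)\le b(t)\le a(t)$ are the values of $r(\cdot,t)$ in the directions of the three coordinate axes, in increasing order, the two axis ratios of $E(t)$ are $y_1(t)=c(t)/a(t)$ and $y_2(t)=b(t)/a(t)$. "Monotonically" is meant in the non-strict sense (an axis ratio equal to $1$ stays equal to $1$). *)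

theory Defs
  imports "HOL-Analysis.Analysis"
begin

definition strict_convex_on :: "real set \<Rightarrow> (real \<Rightarrow> real) \<Rightarrow> bool" where
  "strict_convex_on S f \<longleftrightarrow> convex S \<and>
     (\<forall>x\<in>S. \<forall>y\<in>S. \<forall>t. x \<noteq> y \<and> 0 < t \<and> t < 1 \<longrightarrow>
        f ((1 - t) * x + t * y) < (1 - t) * f x + t * f y)"

definition strict_concave_on :: "real set \<Rightarrow> (real \<Rightarrow> real) \<Rightarrow> bool" where
  "strict_concave_on S f \<longleftrightarrow> strict_convex_on S (\<lambda>x. - f x)"

definition convex_body :: "(real ^ 3) set \<Rightarrow> bool" where
  "convex_body K \<longleftrightarrow> convex K \<and> compact K \<and> interior K \<noteq> {}"

text \<open>The solid ellipsoid centred at the origin with semi-axis \<open>p $ i\<close> along the \<open>i\<close>-th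
  coordinate axis; it is only meaningful for positive \<open>p $ i\<close>.\<close>

definition axis_ellipsoid :: "real ^ 3 \<Rightarrow> (real ^ 3) set" where
  "axis_ellipsoid p = {x. (\<Sum>i\<in>UNIV. (x $ i / p $ i)\<^sup>2) \<le> 1}"

definition coordinate_axes :: "(real ^ 3) set" where
  "coordinate_axes = {x. \<exists>i s. x = s *\<^sub>R axis i 1}"

text \<open>The semi-axes of the approximating ellipsoid. They exist and are unique when \<open>K\<close> is a convex
  body symmetric with respect to the three coordinate planes: then \<open>frontier K\<close> meets the
  \<open>i\<close>-th coordinate axis in exactly two points, which are opposite to each other.\<close>

definition approx_semi_axes :: "(real ^ 3) set \<Rightarrow> real ^ 3" where
  "approx_semi_axes K = (THE p. (\<forall>i. 0 < p $ i) \<and>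
     frontier K \<inter> coordinate_axes \<subseteq> frontier (axis_ellipsoid p))"

definition sorted_semi_axes :: "(real ^ 3) set \<Rightarrow> real list" where
  "sorted_semi_axes K =
     sort [approx_semi_axes K $ 1, approx_semi_axes K $ 2, approx_semi_axes K $ 3]"

text \<open>With \<open>sorted_semi_axes K = [c, b, a]\<close>, so \<open>c \<le> b \<le> a\<close>, the axis ratios are
  \<open>c / a\<close> and \<open>b / a\<close>.\<close>

definition axis_ratio1 :: "(real ^ 3) set \<Rightarrow> real" where
  "axis_ratio1 K = sorted_semi_axes K ! 0 / sorted_semi_axes K ! 2"

definition axis_ratio2 :: "(real ^ 3) set \<Rightarrow> real" where
  "axis_ratio2 K = sorted_semi_axes K ! 1 / sorted_semi_axes K ! 2"

text \<open>A family of convex bodies \<open>E t\<close>, for \<open>t\<close> in the time domain \<open>I\<close>, evolving under the flow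
  \<open>r\<^sub>t = f r\<close>; here \<open>r u t\<close> is the radial distance of \<open>E t\<close> in the direction of the unit vector \<open>u\<close>.
  The second conjunct at \<open>t = 0\<close> is the initial condition on \<open>r u 0\<close>. Symmetry with respect to the
  coordinate planes is not required separately, as the flow transmits it from \<open>E 0\<close>.\<close>

definition radial_flow ::
  "(real \<Rightarrow> real) \<Rightarrow> real set \<Rightarrow> (real \<Rightarrow> (real ^ 3) set) \<Rightarrow> (real ^ 3 \<Rightarrow> real \<Rightarrow> real) \<Rightarrow> bool" where
  "radial_flow f I E r \<longleftrightarrow>
     (\<forall>t\<in>I. convex_body (E t)) \<and>
     (\<forall>t\<in>I. frontier (E t) = (\<lambda>u. r u t *\<^sub>R u) ` sphere 0 1) \<and>
     (\<forall>u\<in>sphere 0 1. \<forall>t\<in>I. 0 \<le> r u t) \<and>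
     (\<forall>u\<in>sphere 0 1. \<forall>t\<in>I. (r u has_real_derivative f (r u t)) (at t within I))"

end

theory Submission
  imports Defs
begin

text \<open>The distances \<open>r\<^sub>i(t)\<close> of the boundary along the coordinate axes are three solutions of the
  same scalar equation \<open>x' = f x\<close>, and the axis ratios are quotients of two of them, so the question
  is one-dimensional. For positive solutions \<open>x \<le> y\<close> the quotient rule gives
  \<open>(x / y)' = (x / y) * (f x / x - f y / y)\<close>. As \<open>f 0 = 0\<close>, the number \<open>f x / x\<close> is the slope of
  the chord of \<open>f\<close> from \<open>0\<close> to \<open>x\<close>; it increases with \<open>x\<close> if \<open>f\<close> is convex and decreases if \<open>f\<close> is
  concave. Hence \<open>x / y\<close> decreases or increases accordingly
  (\<open>slope_mono_if_strict_convex_on\<close>, \<open>ratio_antimono_on_if_slope_mono\<close>,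
  \<open>ratio_mono_on_if_slope_antimono\<close>).

  This needs two facts about the flow. Since \<open>f\<close> is decreasing, the gap between two solutions cannot
  grow, so solutions keep their order (\<open>flow_solution_comparison\<close>). Thus the same axis stays the
  shortest, the middle and the longest one for all times; applied in both directions, the comparison
  also shows that opposite axis points stay opposite. And solutions do not reach \<open>0\<close> in finite time,
  because \<open>f\<close> is Lipschitz near \<open>0\<close> (\<open>flow_solution_pos\<close>).

  It remains to see that the \<open>r\<^sub>i(t)\<close> really are the semi-axes of the approximating ellipsoid, for
  which the boundary points on the axes are computed
  (\<open>scaled_axis_mem_radial_image_iff\<close>, \<open>approx_semi_axes_eqI\<close>).\<close>

section \<open>Scalar flows\<close>

lemma mono_on_if_deriv_nonneg:
  fixes g g' :: "real \<Rightarrow> real"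
  assumes "is_interval I"
    and deriv: "\<And>s. s \<in> I \<Longrightarrow> (g has_real_derivative g' s) (at s within I)"
    and nonneg: "\<And>s. s \<in> I \<Longrightarrow> 0 \<le> g' s"
  shows "mono_on I g"
proof (intro mono_onI)
  fix s t assume st: "s \<in> I" "t \<in> I" "s \<le> t"
  have sub: "{s..t} \<subseteq> I"
    using assms(1) st by (meson atLeastAtMost_iff mem_is_interval_1_I subsetI)
  have "(g has_derivative (*) (g' z)) (at z within {s..t})" if "s \<le> z" "z \<le> t" for z
    using has_field_derivative_subset[OF deriv sub, of z] that sub
    by (auto simp: has_field_derivative_def)
  then obtain z where z: "z \<in> {s..t}" "g t - g s = g' z * (t - s)"
    using mvt_very_simple[OF st(3), of g "\<lambda>z. (*) (g' z)"] by auto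
  then show "g s \<le> g t"
    using nonneg[of z] sub st(3) by (smt (verit) mult_nonneg_nonneg subsetD)
qed

lemma antimono_on_if_deriv_nonpos:
  fixes g g' :: "real \<Rightarrow> real"
  assumes "is_interval I"
    and deriv: "\<And>s. s \<in> I \<Longrightarrow> (g has_real_derivative g' s) (at s within I)"
    and nonpos: "\<And>s. s \<in> I \<Longrightarrow> g' s \<le> 0"
  shows "antimono_on I g"
proof -
  have "mono_on I (\<lambda>s. - g s)"
    by (rule mono_on_if_deriv_nonneg[where g' = "\<lambda>s. - g' s"])
      (use assms in \<open>auto intro: DERIV_minus\<close>)
  then show ?thesis
    by (simp add: monotone_on_def)
qed

definition flow_solution :: "(real \<Rightarrow> real) \<Rightarrow> real set \<Rightarrow> (real \<Rightarrow> real) \<Rightarrow> bool" where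
  "flow_solution f I x \<longleftrightarrow>
     (\<forall>t\<in>I. 0 \<le> x t \<and> (x has_real_derivative f (x t)) (at t within I))"

text \<open>If the order failed at time \<open>t\<close>, then after the last time at which it held \<open>x\<close> would be the larger
  solution, hence \<open>f x \<le> f y\<close> there and the difference \<open>x - y\<close> could not have become positive.
  Monotonicity of \<open>f\<close> thus takes the place of a Lipschitz condition. Uniqueness forward in time is the
  case of equal initial values.\<close>

lemma flow_solution_comparison:
  assumes anti: "antimono_on {0..} f"
    and I: "is_interval I" "0 \<in> I"
    and x: "flow_solution f I x" and y: "flow_solution f I y"
    and init: "x 0 \<le> y 0"
    and t: "t \<in> I" "0 \<le> t"
  shows "x t \<le> y t"
proof (rule ccontr)
  define d where "d s = x s - y s" for s
  assume "\<not> x t \<le> y t"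
  then have dt: "0 < d t" by (simp add: d_def)
  have d0: "d 0 \<le> 0" using init by (simp add: d_def)
  have sub: "{0..t} \<subseteq> I"
    using I t by (meson atLeastAtMost_iff mem_is_interval_1_I subsetI)
  have deriv: "(d has_real_derivative f (x s) - f (y s)) (at s within I)" if "s \<in> I" for s
    using x y that unfolding flow_solution_def d_def by (auto intro!: DERIV_diff)
  have cont: "continuous_on {0..t} d"
    by (rule DERIV_continuous_on[where D = "\<lambda>s. f (x s) - f (y s)"],
        rule has_field_derivative_subset[OF deriv sub]) (use sub in auto)
  define Z where "Z = {s \<in> {0..t}. d s \<le> 0}"
  have "compact Z"
  proof -
    have "closed ({0..t} \<inter> d -` {..0})"
      using cont by (intro continuous_closed_preimage) auto
    then have "closed Z"
      by (rule back_subst[of closed]) (auto simp: Z_def)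
    moreover have "bounded Z"
      by (rule bounded_subset[OF bounded_closed_interval[of 0 t]]) (auto simp: Z_def)
    ultimately show ?thesis
      by (simp add: compact_eq_bounded_closed)
  qed
  moreover have "Z \<noteq> {}" using d0 t by (auto simp: Z_def)
  \<comment> \<open>\<open>s\<close> is the last time up to \<open>t\<close> at which the order holds.\<close>
  ultimately obtain s where s: "s \<in> Z" and last: "\<And>z. z \<in> Z \<Longrightarrow> z \<le> s"
    using compact_attains_sup[of Z] by blast
  have st: "0 \<le> s" "s < t" "d s \<le> 0"
    using s dt by (auto simp: Z_def less_le)
  have "(d has_derivative (*) (f (x z) - f (y z))) (at z within {s..t})" if "s \<le> z" "z \<le> t" for z
    unfolding has_field_derivative_def[symmetric]
    by (rule has_field_derivative_subset[OF deriv]) (use that sub st in auto)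
  then obtain z where z: "s < z" "z < t" "d t - d s = (f (x z) - f (y z)) * (t - s)"
    using mvt_simple[OF st(2), of d "\<lambda>z. (*) (f (x z) - f (y z))"] by auto
  then have "0 < d z" "z \<in> I"
    using last[of z] st sub by (auto simp: Z_def not_le[symmetric])
  then have "f (x z) \<le> f (y z)"
    using anti x y by (auto simp: flow_solution_def d_def monotone_on_def)
  then have "(f (x z) - f (y z)) * (t - s) \<le> 0"
    using st by (simp add: mult_nonpos_nonneg)
  then show False using z st dt by linarith
qed

text \<open>As the solution decreases, it stays in \<open>{0..x 0}\<close>, where a bound \<open>L\<close> for \<open>\<bar>f'\<bar>\<close> gives
  \<open>f z \<ge> - L * z\<close>. Hence the solution decays at most exponentially: \<open>exp (L * t) * x t\<close> does not
  decrease.\<close>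

lemma flow_solution_pos:
  assumes f_deriv: "\<And>x. 0 \<le> x \<Longrightarrow> (f has_real_derivative f' x) (at x within {0..})"
    and f'_cont: "continuous_on {0..} f'"
    and f_zero: "f 0 = 0"
    and nonpos: "\<And>x. 0 \<le> x \<Longrightarrow> f x \<le> 0"
    and I: "is_interval I" "0 \<in> I"
    and x: "flow_solution f I x"
    and init: "0 < x 0"
    and t: "t \<in> I" "0 \<le> t"
  shows "0 < x t"
proof -
  have sub: "{0..t} \<subseteq> I"
    using I t by (meson atLeastAtMost_iff mem_is_interval_1_I subsetI)
  have deriv: "(x has_real_derivative f (x s)) (at s within {0..t})" if "s \<in> {0..t}" for s
    using x sub that has_field_derivative_subset unfolding flow_solution_def by blast
  have x_nonneg: "0 \<le> x s" if "s \<in> {0..t}" for s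
    using x sub that by (auto simp: flow_solution_def)
  have "antimono_on {0..t} x"
    by (rule antimono_on_if_deriv_nonpos[where g' = "\<lambda>s. f (x s)"])
      (use deriv nonpos x_nonneg in \<open>auto simp: is_interval_cc\<close>)
  then have le: "x s \<le> x 0" if "s \<in> {0..t}" for s
    using that by (auto simp: monotone_on_def)
  have "compact (f' ` {0..x 0})"
    using f'_cont by (intro compact_continuous_image) (auto intro: continuous_on_subset)
  then obtain L where L: "\<And>z. z \<in> {0..x 0} \<Longrightarrow> \<bar>f' z\<bar> \<le> L"
    by (metis bounded_iff compact_imp_bounded imageI real_norm_def)
  have bound: "- L * z \<le> f z" if "z \<in> {0..x 0}" for z
  proof -
    have "norm (f z - f 0) \<le> L * norm (z - 0)"
    proof (rule field_differentiable_bound[where S = "{0..x 0}" and f' = f'])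
      show "(f has_real_derivative f' y) (at y within {0..x 0})" if "y \<in> {0..x 0}" for y
        by (rule has_field_derivative_subset[OF f_deriv]) (use that in auto)
    qed (use that init L in auto)
    then show ?thesis using that f_zero by auto
  qed
  have "mono_on {0..t} (\<lambda>s. exp (L * s) * x s)"
  proof (rule mono_on_if_deriv_nonneg[where g' = "\<lambda>s. exp (L * s) * (L * x s + f (x s))"])
    fix s assume s: "s \<in> {0..t}"
    show "((\<lambda>s. exp (L * s) * x s) has_real_derivative exp (L * s) * (L * x s + f (x s)))
            (at s within {0..t})"
      by (rule derivative_eq_intros deriv[OF s] refl)+ (simp add: algebra_simps)
    show "0 \<le> exp (L * s) * (L * x s + f (x s))"
      using bound[of "x s"] le[OF s] x_nonneg[OF s] by auto
  qed (simp add: is_interval_cc)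
  from mono_onD[OF this, of 0 t] have "exp (L * 0) * x 0 \<le> exp (L * t) * x t"
    using t by simp
  then have "0 < exp (L * t) * x t"
    using init by simp
  then show ?thesis
    by (simp add: zero_less_mult_iff)
qed

lemma antimono_on_atLeast_if_greaterThan:
  fixes f :: "real \<Rightarrow> real"
  assumes cont: "continuous_on {0..} f" and anti: "antimono_on {0<..} f"
  shows "antimono_on {0..} f"
proof -
  have at0: "f x \<le> f 0" if "0 < x" for x
  proof (rule tendsto_lowerbound)
    show "(f \<longlongrightarrow> f 0) (at_right 0)"
      using cont unfolding continuous_on_def
      by (auto intro: tendsto_within_subset[where S = "{0..}"])
    show "\<forall>\<^sub>F z in at_right 0. f x \<le> f z"
      using that monotone_onD[OF anti, of _ x]
      by (auto simp: eventually_at_right[OF that] intro!: exI[of _ x])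
  qed simp
  show ?thesis
  proof (rule monotone_onI)
    fix x y :: real assume "x \<in> {0..}" "y \<in> {0..}" "x \<le> y"
    then show "f y \<le> f x"
      using at0[of y] monotone_onD[OF anti, of x y] by (cases "x = 0"; cases "y = 0") auto
  qed
qed

text \<open>Convexity is only given on the open half-line, while the chord in question starts at \<open>0\<close>. The
  convexity inequality is therefore taken on the chord from a small \<open>e > 0\<close> to \<open>y\<close>, and \<open>e\<close> tends
  to \<open>0\<close>.\<close>

lemma slope_mono_if_strict_convex_on:
  assumes cont: "continuous_on {0..} f" and f0: "f 0 = 0"
    and conv: "strict_convex_on {0<..} f"
    and xy: "0 < x" "x \<le> y"
  shows "f x / x \<le> f y / y"
proof (cases "x = y")
  case False
  define s where "s = x / y"
  have s: "0 < s" "s < 1" "s * y = x" using xy False by (auto simp: s_def)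
  have lim: "((\<lambda>e. f (g e)) \<longlongrightarrow> f (g 0)) (at_right 0)"
    if "continuous_on {0..} g" "\<And>e. 0 \<le> e \<Longrightarrow> 0 \<le> g e" for g :: "real \<Rightarrow> real"
  proof -
    have "continuous_on {0..} (\<lambda>e. f (g e))"
      using that by (intro continuous_on_compose2[OF cont]) auto
    then show ?thesis
      unfolding continuous_on_def by (auto intro: tendsto_within_subset[where S = "{0..}"])
  qed
  have "f ((1 - s) * 0 + s * y) \<le> (1 - s) * f 0 + s * f y"
  proof (rule tendsto_le)
    show "((\<lambda>e. f ((1 - s) * e + s * y)) \<longlongrightarrow> f ((1 - s) * 0 + s * y)) (at_right 0)"
      by (rule lim) (use s xy in \<open>auto intro!: continuous_intros\<close>)
    show "((\<lambda>e. (1 - s) * f e + s * f y) \<longlongrightarrow> (1 - s) * f 0 + s * f y) (at_right 0)"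
      by (intro tendsto_intros lim[of "\<lambda>e. e"]) auto
    have "\<forall>\<^sub>F e in at_right 0. 0 < e \<and> e < y"
      using xy by (auto simp: eventually_at_right[of 0 y] intro: exI[of _ y])
    then show "\<forall>\<^sub>F e in at_right 0. f ((1 - s) * e + s * y) \<le> (1 - s) * f e + s * f y"
      by eventually_elim
        (use conv s in \<open>auto simp: strict_convex_on_def intro!: less_imp_le\<close>)
  qed simp
  then have "f x \<le> x / y * f y" using s(3) f0 by (simp add: s_def)
  then show ?thesis using xy by (simp add: field_simps)
qed simp

lemma has_real_derivative_ratio_of_flow_solutions:
  assumes "flow_solution f I x" "flow_solution f I y" "s \<in> I" "0 < x s" "0 < y s"
  shows "((\<lambda>t. x t / y t) has_real_derivative x s / y s * (f (x s) / x s - f (y s) / y s))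
           (at s within I)"
proof -
  have "((\<lambda>t. x t / y t) has_real_derivative (f (x s) * y s - x s * f (y s)) / (y s * y s))
          (at s within I)"
    using assms by (intro DERIV_divide) (auto simp: flow_solution_def)
  then show ?thesis
    by (rule DERIV_cong) (use assms in \<open>simp add: field_simps\<close>)
qed

lemma ratio_antimono_on_if_slope_mono:
  assumes "is_interval I" and sol: "flow_solution f I x" "flow_solution f I y"
    and pos: "\<And>s. s \<in> I \<Longrightarrow> 0 < x s" and le: "\<And>s. s \<in> I \<Longrightarrow> x s \<le> y s"
    and slope: "\<And>a b. 0 < a \<Longrightarrow> a \<le> b \<Longrightarrow> f a / a \<le> f b / b"
  shows "antimono_on I (\<lambda>t. x t / y t)"
proof (rule antimono_on_if_deriv_nonpos[OF assms(1)])
  fix s assume s: "s \<in> I"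
  have y: "0 < y s" using pos[OF s] le[OF s] by linarith
  show "((\<lambda>t. x t / y t) has_real_derivative x s / y s * (f (x s) / x s - f (y s) / y s))
          (at s within I)"
    by (rule has_real_derivative_ratio_of_flow_solutions[OF sol s pos[OF s] y])
  show "x s / y s * (f (x s) / x s - f (y s) / y s) \<le> 0"
    using slope[OF pos[OF s] le[OF s]] pos[OF s] y by (intro mult_nonneg_nonpos) auto
qed

lemma ratio_mono_on_if_slope_antimono:
  assumes "is_interval I" and sol: "flow_solution f I x" "flow_solution f I y"
    and pos: "\<And>s. s \<in> I \<Longrightarrow> 0 < x s" and le: "\<And>s. s \<in> I \<Longrightarrow> x s \<le> y s"
    and slope: "\<And>a b. 0 < a \<Longrightarrow> a \<le> b \<Longrightarrow> f b / b \<le> f a / a"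
  shows "mono_on I (\<lambda>t. x t / y t)"
proof (rule mono_on_if_deriv_nonneg[OF assms(1)])
  fix s assume s: "s \<in> I"
  have y: "0 < y s" using pos[OF s] le[OF s] by linarith
  show "((\<lambda>t. x t / y t) has_real_derivative x s / y s * (f (x s) / x s - f (y s) / y s))
          (at s within I)"
    by (rule has_real_derivative_ratio_of_flow_solutions[OF sol s pos[OF s] y])
  show "0 \<le> x s / y s * (f (x s) / x s - f (y s) / y s)"
    using slope[OF pos[OF s] le[OF s]] pos[OF s] y by (intro mult_nonneg_nonneg) auto
qed

section \<open>Approximating ellipsoids\<close>

text \<open>Scaling a point by \<open>1 + d\<close> multiplies the defining quadratic form by \<open>(1 + d)\<^sup>2\<close>, so a point where
  the form equals \<open>1\<close> leaves the ellipsoid when pushed outwards and cannot be interior.\<close>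

lemma frontier_axis_ellipsoid:
  fixes p :: "real ^ 3"
  assumes p: "\<And>i. 0 < p $ i"
  shows "frontier (axis_ellipsoid p) = {x. (\<Sum>i\<in>UNIV. (x $ i / p $ i)\<^sup>2) = 1}"
proof -
  define N where "N x = (\<Sum>i\<in>UNIV. (x $ i / p $ i)\<^sup>2)" for x :: "real ^ 3"
  have N_cont: "continuous_on UNIV N"
    unfolding N_def using p by (intro continuous_intros) (auto simp: less_imp_neq[symmetric])
  have E: "axis_ellipsoid p = {x. N x \<le> 1}"
    by (simp add: axis_ellipsoid_def N_def)
  have "closed {x. N x \<le> 1}"
    using N_cont by (intro closed_Collect_le) auto
  moreover have "interior {x. N x \<le> 1} = {x. N x < 1}"
  proof
    have "open {x. N x < 1}"
      using N_cont by (intro open_Collect_less) auto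
    then show "{x. N x < 1} \<subseteq> interior {x. N x \<le> 1}"
      by (intro interior_maximal) auto
    show "interior {x. N x \<le> 1} \<subseteq> {x. N x < 1}"
    proof
      fix x assume x: "x \<in> interior {x. N x \<le> 1}"
      have "((\<lambda>d. (1 + d) *\<^sub>R x) \<longlongrightarrow> (1 + 0) *\<^sub>R x) (at_right (0::real))"
        by (intro tendsto_intros)
      then have "\<forall>\<^sub>F d in at_right (0::real). (1 + d) *\<^sub>R x \<in> interior {x. N x \<le> 1}"
        by (rule topological_tendstoD) (use x in auto)
      then have "\<forall>\<^sub>F d in at_right (0::real). 0 < d \<and> (1 + d) *\<^sub>R x \<in> interior {x. N x \<le> 1}"
        using eventually_at_right_less eventually_conj by blast
      then obtain d :: real where d: "0 < d" "(1 + d) *\<^sub>R x \<in> interior {x. N x \<le> 1}"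
        by (metis (mono_tags, lifting) eventually_happens' trivial_limit_at_right_real)
      have "N ((1 + d) *\<^sub>R x) = (1 + d)\<^sup>2 * N x"
        by (simp add: N_def sum_distrib_left power_mult_distrib power_divide)
      moreover have "N ((1 + d) *\<^sub>R x) \<le> 1" using d(2) interior_subset by blast
      moreover have "1 < (1 + d)\<^sup>2" using d(1) by (simp add: one_less_power)
      ultimately have "N x \<noteq> 1" by auto
      moreover have "N x \<le> 1" using x interior_subset by blast
      ultimately show "x \<in> {x. N x < 1}" by simp
    qed
  qed
  ultimately show ?thesis
    unfolding E frontier_def by (auto simp: N_def)
qed

lemma sum_scaled_axis:
  fixes p :: "real ^ 3"
  shows "(\<Sum>j\<in>UNIV. ((s *\<^sub>R axis i 1) $ j / p $ j)\<^sup>2) = (s / p $ i)\<^sup>2"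
proof -
  have "(\<Sum>j\<in>UNIV. ((s *\<^sub>R axis i 1) $ j / p $ j)\<^sup>2)
      = (\<Sum>j\<in>UNIV. if j = i then (s / p $ i)\<^sup>2 else 0)"
    by (intro sum.cong) (auto simp: axis_def)
  then show ?thesis by simp
qed

lemma scaled_axis_mem_frontier_axis_ellipsoid_iff:
  assumes "\<And>i. 0 < p $ i"
  shows "s *\<^sub>R axis i 1 \<in> frontier (axis_ellipsoid p) \<longleftrightarrow> \<bar>s\<bar> = p $ i"
proof -
  have "(s / p $ i)\<^sup>2 = 1 \<longleftrightarrow> \<bar>s\<bar> = p $ i"
    using assms[of i] by (auto simp: power2_eq_1_iff divide_eq_eq abs_if split: if_splits)
  then show ?thesis
    by (simp only: frontier_axis_ellipsoid[OF assms] mem_Collect_eq sum_scaled_axis)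
qed

text \<open>An axis ellipsoid is determined by its boundary points on the coordinate axes, which makes the
  definite description in the definition of the semi-axes well-defined.\<close>

lemma approx_semi_axes_eqI:
  assumes q: "\<And>i. 0 < q $ i"
    and fr: "\<And>i s. s *\<^sub>R axis i 1 \<in> frontier K \<longleftrightarrow> \<bar>s\<bar> = q $ i"
  shows "approx_semi_axes K = q"
  unfolding approx_semi_axes_def
proof (rule the_equality)
  show "(\<forall>i. 0 < q $ i) \<and> frontier K \<inter> coordinate_axes \<subseteq> frontier (axis_ellipsoid q)"
    using q fr by (auto simp: coordinate_axes_def scaled_axis_mem_frontier_axis_ellipsoid_iff)
next
  fix p assume p: "(\<forall>i. 0 < p $ i) \<and> frontier K \<inter> coordinate_axes \<subseteq> frontier (axis_ellipsoid p)"
  have "q $ i = p $ i" for i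
  proof -
    have "(q $ i) *\<^sub>R axis i 1 \<in> frontier K"
      using fr q[of i] by simp
    then have "(q $ i) *\<^sub>R axis i 1 \<in> frontier (axis_ellipsoid p)"
      using p unfolding coordinate_axes_def by blast
    then show ?thesis
      using p q[of i] by (simp add: scaled_axis_mem_frontier_axis_ellipsoid_iff)
  qed
  then show "p = q" by (simp add: vec_eq_iff)
qed

text \<open>This replaces the sorting, which depends on the body, by a labelling \<open>i\<close>, \<open>j\<close>, \<open>k\<close> of the axes that
  can be chosen once for all times.\<close>

lemma sorted_semi_axes_eqI:
  assumes "approx_semi_axes K = q" and "UNIV = {i, j, k}" and "q $ i \<le> q $ j" "q $ j \<le> q $ k"
  shows "sorted_semi_axes K = [q $ i, q $ j, q $ k]"
proof -
  have mset_eq: "mset [q $ a, q $ b, q $ c] = image_mset (($) q) (mset_set UNIV)"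
    if U: "UNIV = {a, b, c}" for a b c :: 3
  proof -
    have "card {a, b, c} = 3" unfolding U[symmetric] by simp
    then have "distinct [a, b, c]"
      by (auto simp: card_insert_if split: if_splits)
    then have "mset_set (set [a, b, c]) = mset [a, b, c]"
      by (rule mset_set_set)
    then have "mset_set UNIV = mset [a, b, c]" by (simp only: U list.set)
    then show ?thesis by simp
  qed
  have "sort [q $ 1, q $ 2, q $ 3] = [q $ i, q $ j, q $ k]"
  proof (rule properties_for_sort)
    show "mset [q $ i, q $ j, q $ k] = mset [q $ 1, q $ 2, q $ 3]"
      by (simp only: mset_eq[OF assms(2)] mset_eq[OF UNIV_3])
    show "sorted [q $ i, q $ j, q $ k]" using assms(3,4) by simp
  qed
  then show ?thesis by (simp add: sorted_semi_axes_def assms(1))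
qed

lemma exists_sorting_of_coordinates:
  fixes p :: "real ^ 3"
  obtains i j k where "UNIV = {i, j, k}" "p $ i \<le> p $ j" "p $ j \<le> p $ k"
proof -
  have "UNIV = {1, 2, 3::3}" "UNIV = {1, 3, 2::3}" "UNIV = {2, 1, 3::3}"
    "UNIV = {2, 3, 1::3}" "UNIV = {3, 1, 2::3}" "UNIV = {3, 2, 1::3}"
    by (auto simp: UNIV_3)
  then have "\<exists>i j k. UNIV = {i, j, k} \<and> p $ i \<le> p $ j \<and> p $ j \<le> p $ k"
    by (meson linear)
  then show thesis using that by blast
qed

section \<open>Radial flows starting at an ellipsoid\<close>

text \<open>Since \<open>\<rho>\<close> is positive, the point \<open>\<rho> u *\<^sub>R u\<close> lies on the \<open>i\<close>-th axis only for the two directions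
  \<open>u = axis i 1\<close> and \<open>u = - axis i 1\<close>.\<close>

lemma scaled_axis_mem_radial_image_iff:
  fixes \<rho> :: "real ^ 'n \<Rightarrow> real"
  assumes pos: "\<And>u. norm u = 1 \<Longrightarrow> 0 < \<rho> u"
    and sym: "\<rho> (- axis i 1) = \<rho> (axis i 1)"
  shows "s *\<^sub>R axis i 1 \<in> (\<lambda>u. \<rho> u *\<^sub>R u) ` sphere 0 1 \<longleftrightarrow> \<bar>s\<bar> = \<rho> (axis i 1)"
proof
  assume "s *\<^sub>R axis i 1 \<in> (\<lambda>u. \<rho> u *\<^sub>R u) ` sphere 0 1"
  then obtain u where u: "norm u = 1" and eq: "s *\<^sub>R axis i 1 = \<rho> u *\<^sub>R u"
    by auto
  have s: "\<bar>s\<bar> = \<rho> u"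
    using arg_cong[OF eq, of norm] pos[OF u] u by simp
  have "u = (1 / \<rho> u) *\<^sub>R (s *\<^sub>R axis i 1)"
    using eq pos[OF u] by simp
  also have "\<dots> = (s / \<bar>s\<bar>) *\<^sub>R axis i 1" by (simp add: s)
  finally have u_eq: "u = (s / \<bar>s\<bar>) *\<^sub>R axis i 1" .
  have "s \<noteq> 0" using s pos[OF u] by auto
  then have "s / \<bar>s\<bar> = 1 \<or> s / \<bar>s\<bar> = - 1" by (auto simp: abs_if)
  then have "u = axis i 1 \<or> u = - axis i 1"
    using u_eq by (metis scaleR_one scaleR_minus_left)
  then show "\<bar>s\<bar> = \<rho> (axis i 1)" using s sym by auto
next
  assume s: "\<bar>s\<bar> = \<rho> (axis i 1)"
  show "s *\<^sub>R axis i 1 \<in> (\<lambda>u. \<rho> u *\<^sub>R u) ` sphere 0 1"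
  proof (cases "0 \<le> s")
    case True
    then show ?thesis using s by (intro image_eqI[where x = "axis i 1"]) auto
  next
    case False
    then have "s = - \<rho> (- axis i 1)" using s sym by simp
    then show ?thesis by (intro image_eqI[where x = "- axis i 1"]) auto
  qed
qed

theorem theorem2:
  fixes f f' :: "real \<Rightarrow> real"
    and I :: "real set"
    and E :: "real \<Rightarrow> (real ^ 3) set"
    and r :: "real ^ 3 \<Rightarrow> real \<Rightarrow> real"
    and p :: "real ^ 3"
  assumes f_deriv: "\<And>x. 0 \<le> x \<Longrightarrow> (f has_real_derivative f' x) (at x within {0..})"
    and f'_cont: "continuous_on {0..} f'"
    and f_zero: "f 0 = 0"
    and f_decreasing: "strict_antimono_on {0<..} f"
    and f_shape: "strict_convex_on {0<..} f \<or> strict_concave_on {0<..} f"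
    and I_interval: "is_interval I" "0 \<in> I" "I \<subseteq> {0..}"
    and flow: "radial_flow f I E r"
    and p_pos: "\<And>i. 0 < p $ i"
    and E_initial: "E 0 = axis_ellipsoid p"
  shows "(strict_convex_on {0<..} f \<longrightarrow>
            antimono_on I (\<lambda>t. axis_ratio1 (E t)) \<and> antimono_on I (\<lambda>t. axis_ratio2 (E t))) \<and>
         (strict_concave_on {0<..} f \<longrightarrow>
            mono_on I (\<lambda>t. axis_ratio1 (E t)) \<and> mono_on I (\<lambda>t. axis_ratio2 (E t)))"
proof -
  have f_cont: "continuous_on {0..} f"
    using f_deriv by (auto intro!: DERIV_continuous_on)
  have anti: "antimono_on {0..} f"
    using f_decreasing
    by (intro antimono_on_atLeast_if_greaterThan f_cont)
      (auto simp: monotone_on_def less_le)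
  have nonpos: "f x \<le> 0" if "0 \<le> x" for x
    using monotone_onD[OF anti, of 0 x] that f_zero by simp
  have sol: "flow_solution f I (r u)" if "norm u = 1" for u
    using flow that by (auto simp: radial_flow_def flow_solution_def)
  have frontier_E: "frontier (E t) = (\<lambda>u. r u t *\<^sub>R u) ` sphere 0 1" if "t \<in> I" for t
    using flow that by (auto simp: radial_flow_def)
  have t_nonneg: "0 \<le> t" if "t \<in> I" for t
    using that I_interval by auto

  \<comment> \<open>The origin is not a boundary point of the ellipsoid, so the flow starts at positive distances.\<close>
  have init_mem: "r u 0 *\<^sub>R u \<in> frontier (axis_ellipsoid p)" if "norm u = 1" for u
    using frontier_E[OF I_interval(2)] that E_initial by auto
  have init_pos: "0 < r u 0" if u: "norm u = 1" for u
  proof -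
    have "r u 0 \<noteq> 0"
      using init_mem[OF u] by (auto simp: frontier_axis_ellipsoid[OF p_pos])
    moreover have "0 \<le> r u 0"
      using sol[OF u] I_interval by (auto simp: flow_solution_def)
    ultimately show ?thesis by simp
  qed
  have init_axis: "r (axis i 1) 0 = p $ i" for i
    using init_mem[of "axis i 1"] init_pos[of "axis i 1"]
    by (simp add: scaled_axis_mem_frontier_axis_ellipsoid_iff[OF p_pos])
  have init_neg_axis: "r (- axis i 1) 0 = p $ i" for i
    using init_mem[of "- axis i 1"] init_pos[of "- axis i 1"]
      scaled_axis_mem_frontier_axis_ellipsoid_iff[OF p_pos, of "- r (- axis i 1) 0" i]
    by simp

  have r_pos: "0 < r u t" if "norm u = 1" "t \<in> I" for u t
    by (rule flow_solution_pos[OF f_deriv f'_cont f_zero nonpos I_interval(1,2) sol init_pos])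
      (use that t_nonneg in auto)
  have r_le: "r u t \<le> r v t" if "norm u = 1" "norm v = 1" "r u 0 \<le> r v 0" "t \<in> I" for u v t
    by (rule flow_solution_comparison[OF anti I_interval(1,2) sol sol])
      (use that t_nonneg in auto)
  \<comment> \<open>Opposite axis points start at equal distances; comparing them both ways keeps these equal.\<close>
  have r_sym: "r (- axis i 1) t = r (axis i 1) t" if "t \<in> I" for i t
    by (rule antisym; rule r_le) (use that in \<open>auto simp: init_axis init_neg_axis\<close>)

  define q where "q t = (\<chi> i. r (axis i 1) t)" for t
  have semi_axes: "approx_semi_axes (E t) = q t" if t: "t \<in> I" for t
  proof (rule approx_semi_axes_eqI)
    show "0 < q t $ i" for i
      using r_pos t by (simp add: q_def)
    show "s *\<^sub>R axis i 1 \<in> frontier (E t) \<longleftrightarrow> \<bar>s\<bar> = q t $ i" for i s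
      unfolding frontier_E[OF t] q_def vec_lambda_beta
      by (rule scaled_axis_mem_radial_image_iff) (use r_pos r_sym t in auto)
  qed

  obtain i j k where ijk: "UNIV = {i, j, k}" "p $ i \<le> p $ j" "p $ j \<le> p $ k"
    by (rule exists_sorting_of_coordinates)
  have order: "r (axis m 1) t \<le> r (axis n 1) t" if "p $ m \<le> p $ n" "t \<in> I" for m n t
    by (rule r_le) (use that in \<open>auto simp: init_axis\<close>)
  have "sorted_semi_axes (E t) = [q t $ i, q t $ j, q t $ k]" if "t \<in> I" for t
    by (rule sorted_semi_axes_eqI[OF semi_axes[OF that] ijk(1)])
      (simp_all add: q_def order ijk(2,3) that)
  then have ratio1: "axis_ratio1 (E t) = r (axis i 1) t / r (axis k 1) t"
    and ratio2: "axis_ratio2 (E t) = r (axis j 1) t / r (axis k 1) t" if "t \<in> I" for t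
    using that by (auto simp: axis_ratio1_def axis_ratio2_def q_def)

  have ratio_anti: "antimono_on I (\<lambda>t. r (axis m 1) t / r (axis n 1) t)"
    if conv: "strict_convex_on {0<..} f" and mn: "p $ m \<le> p $ n" for m n
    by (rule ratio_antimono_on_if_slope_mono[OF I_interval(1) sol sol])
      (use r_pos order mn slope_mono_if_strict_convex_on[OF f_cont f_zero conv] in auto)
  have ratio_mono: "mono_on I (\<lambda>t. r (axis m 1) t / r (axis n 1) t)"
    if conc: "strict_concave_on {0<..} f" and mn: "p $ m \<le> p $ n" for m n
  proof (rule ratio_mono_on_if_slope_antimono[OF I_interval(1) sol sol])
    fix a b :: real assume ab: "0 < a" "a \<le> b"
    have "- f a / a \<le> - f b / b"
      using conc f_cont f_zero ab
      by (intro slope_mono_if_strict_convex_on)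
        (auto simp: strict_concave_on_def intro: continuous_intros)
    then show "f b / b \<le> f a / a" by simp
  qed (use r_pos order mn in auto)

  have ik: "p $ i \<le> p $ k" using ijk by linarith
  show ?thesis
    using ratio_anti[OF _ ik] ratio_anti[OF _ ijk(3)] ratio_mono[OF _ ik] ratio_mono[OF _ ijk(3)]
    by (auto simp: monotone_on_def ratio1 ratio2)
qed

end
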